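(* Let $P_n$ be the path on $n$ vertices. Then $\mathrm{UUSN}(P_n) = O(\log n)$ as $n\to\infty$; that is, there exist constants $C>0$ and $n_0$ such that $\mathrm{UUSN}(P_n)\le C\log n$ for all $n\ge n_0$.
   Context: Graphs are finite, simple and undirected. A valid labelling of a graph $G$ with universe a finite set $S$ assigns to the vertices of $G$ pairwise distinct nonempty subsets of $S$ such that two distinct vertices are adjacent if and only if their labels are disjoint. A valid labelling is uniform if all vertex labels have the same number of elements. The uniform universe size number $\mathrm{UUSN}(G)$ is the minimum of $|S|$ over all finite sets $S$ for which $G$ has a uniform valid labelling with universe $S$. *)

theory Defs
  imports Complex_Main "Graph_Theory.Pair_Digraph"
begin

text \<open>
  Finite simple undirected graphs are the symmetric loop-free digraphs of the locale
  \<^locale>\<open>pair_graph\<close>.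
\<close>

definition valid_labelling :: "'a pair_pre_digraph \<Rightarrow> 'b set \<Rightarrow> ('a \<Rightarrow> 'b set) \<Rightarrow> bool" where
  "valid_labelling G S f \<longleftrightarrow>
     finite S \<and>
     inj_on f (pverts G) \<and>
     (\<forall>v\<in>pverts G. f v \<noteq> {} \<and> f v \<subseteq> S) \<and>
     (\<forall>u\<in>pverts G. \<forall>v\<in>pverts G. u \<noteq> v \<longrightarrow> ((u, v) \<in> parcs G \<longleftrightarrow> f u \<inter> f v = {}))"

definition uniform_valid_labelling ::
    "'a pair_pre_digraph \<Rightarrow> 'b set \<Rightarrow> ('a \<Rightarrow> 'b set) \<Rightarrow> bool" where
  "uniform_valid_labelling G S f \<longleftrightarrow>
     valid_labelling G S f \<and> (\<forall>u\<in>pverts G. \<forall>v\<in>pverts G. card (f u) = card (f v))"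

text \<open>
  Universes are taken among the finite sets of natural numbers; \<open>UUSN_le\<close> below shows that
  this does not restrict the minimum, and \<open>UUSN_attained\<close> that the minimum exists.
\<close>

definition UUSN :: "'a pair_pre_digraph \<Rightarrow> nat" where
  "UUSN G = (LEAST k. \<exists>(S :: nat set) f. uniform_valid_labelling G S f \<and> card S = k)"

definition path_graph :: "nat \<Rightarrow> nat pair_pre_digraph" where
  "path_graph n =
     \<lparr> pverts = {..<n},
       parcs = {(i, j). i < n \<and> j < n \<and> (j = Suc i \<or> i = Suc j)} \<rparr>"

lemma pair_graph_path_graph: "pair_graph (path_graph n)"
proof -
  have "finite (parcs (path_graph n))"
    by (rule finite_subset[of _ "{..<n} \<times> {..<n}"]) (auto simp: path_graph_def)
  then show ?thesis
    by unfold_locales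
      (auto simp: path_graph_def symmetric_def arcs_ends_conv with_proj_def sym_def)
qed

lemma uniform_valid_labelling_to_nat:
  assumes "uniform_valid_labelling G S f"
  shows "\<exists>(T :: nat set) g. uniform_valid_labelling G T g \<and> card T = card S"
proof -
  have fin: "finite S" and inj: "inj_on f (pverts G)"
    and sub: "\<And>v. v \<in> pverts G \<Longrightarrow> f v \<noteq> {} \<and> f v \<subseteq> S"
    and adj: "\<And>u v. u \<in> pverts G \<Longrightarrow> v \<in> pverts G \<Longrightarrow> u \<noteq> v \<Longrightarrow>
                (u, v) \<in> parcs G \<longleftrightarrow> f u \<inter> f v = {}"
    and uni: "\<And>u v. u \<in> pverts G \<Longrightarrow> v \<in> pverts G \<Longrightarrow> card (f u) = card (f v)"
    using assms unfolding uniform_valid_labelling_def valid_labelling_def by blast+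
  obtain h :: "_ \<Rightarrow> nat" where h: "inj_on h S"
    using finite_imp_inj_to_nat_seg[OF fin] by blast
  have "inj_on (\<lambda>v. h ` f v) (pverts G)"
    using inj sub h unfolding inj_on_def by (metis inj_on_def inj_on_image_eq_iff)
  moreover have "h ` f u \<inter> h ` f v = {} \<longleftrightarrow> f u \<inter> f v = {}"
    if "u \<in> pverts G" "v \<in> pverts G" for u v
    using inj_on_image_Int[OF h, of "f u" "f v"] sub that by auto
  then have "(u, v) \<in> parcs G \<longleftrightarrow> h ` f u \<inter> h ` f v = {}"
    if "u \<in> pverts G" "v \<in> pverts G" "u \<noteq> v" for u v
    using adj that by simp
  moreover have card_h: "card (h ` f v) = card (f v)" if "v \<in> pverts G" for v
    using sub[OF that] h by (meson card_image inj_on_subset)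
  have "card (h ` f u) = card (h ` f v)" if "u \<in> pverts G" "v \<in> pverts G" for u v
    unfolding card_h[OF that(1)] card_h[OF that(2)] using that by (rule uni)
  moreover have "h ` f v \<noteq> {} \<and> h ` f v \<subseteq> h ` S" if "v \<in> pverts G" for v
    using sub[OF that] by auto
  ultimately have "uniform_valid_labelling G (h ` S) (\<lambda>v. h ` f v)"
    unfolding uniform_valid_labelling_def valid_labelling_def
    using fin by (intro conjI ballI impI finite_imageI) blast+
  moreover have "card (h ` S) = card S"
    using h by (rule card_image)
  ultimately show ?thesis by blast
qed

lemma UUSN_le:
  assumes "uniform_valid_labelling G S f"
  shows "UUSN G \<le> card S"
  unfolding UUSN_def by (rule Least_le) (rule uniform_valid_labelling_to_nat[OF assms])

lemma uniform_valid_labelling_exists: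
  assumes "pair_graph G"
  shows "\<exists>S f. uniform_valid_labelling G S (f :: 'a \<Rightarrow> ('a \<times> 'a) set set)"
proof -
  interpret pair_graph G by fact
  define e where "e = (\<lambda>v u. if u \<noteq> v \<and> (u, v) \<notin> parcs G then {(u, v), (v, u)} else {(v, u)})"
  define f where "f = (\<lambda>v. e v ` pverts G)"
  have sym: "(u, v) \<in> parcs G \<longleftrightarrow> (v, u) \<in> parcs G" for u v
    using pair_sym_arcs by (auto simp: symmetric_def sym_def)
  have inj: "inj_on (e v) (pverts G)" for v
    by (auto simp: inj_on_def e_def doubleton_eq_iff split: if_splits)
  have meet: "e v u = e w x \<longleftrightarrow> u = w \<and> x = v \<and> (v, w) \<notin> parcs G" if "v \<noteq> w" for u v w x
    using that sym by (auto simp: e_def doubleton_eq_iff)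
  have disj: "(v, w) \<in> parcs G \<longleftrightarrow> f v \<inter> f w = {}"
    if "v \<in> pverts G" "w \<in> pverts G" "v \<noteq> w" for v w
  proof -
    have "f v \<inter> f w = {} \<longleftrightarrow> (\<forall>u\<in>pverts G. \<forall>x\<in>pverts G. e v u \<noteq> e w x)"
      unfolding f_def by blast
    then show ?thesis using that by (auto simp: meet)
  qed
  have "inj_on f (pverts G)"
  proof (rule inj_onI)
    fix v w assume v: "v \<in> pverts G" and w: "w \<in> pverts G" and eq: "f v = f w"
    have "e v v \<in> f w" using v eq by (auto simp: f_def)
    then obtain x where "e v v = e w x" by (auto simp: f_def)
    then show "v = w" using meet by blast
  qed
  then have "uniform_valid_labelling G (\<Union>v\<in>pverts G. f v) f"
    unfolding uniform_valid_labelling_def valid_labelling_def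
    using disj pair_finite_verts by (auto simp: f_def card_image[OF inj])
  then show ?thesis by blast
qed

lemma UUSN_attained:
  fixes G :: "'a pair_pre_digraph"
  assumes "pair_graph G"
  shows "\<exists>(S :: nat set) f. uniform_valid_labelling G S f \<and> card S = UUSN G"
proof -
  obtain S f where "uniform_valid_labelling G S (f :: 'a \<Rightarrow> ('a \<times> 'a) set set)"
    using uniform_valid_labelling_exists[OF assms] by (elim exE)
  from uniform_valid_labelling_to_nat[OF this]
  have "\<exists>k. \<exists>(S :: nat set) f. uniform_valid_labelling G S f \<and> card S = k" ..
  then show ?thesis unfolding UUSN_def by (rule LeastI_ex)
qed

end

theory Submission
  imports Defs
begin

text \<open>
  Let \<open>G 0, G 1, \<dots>\<close> be a Gray code on \<open>m\<close> bits. The vertex \<open>2a\<close> of the path is labelled by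
  the bits of \<open>G a\<close>, and the vertex \<open>2b + 1\<close> by the complements of the bits on which its
  two neighbours \<open>G b\<close> and \<open>G (b + 1)\<close> agree. These labels are disjoint exactly if \<open>G a\<close> coincides
  with \<open>G b\<close> outside the single bit where \<open>G b\<close> and \<open>G (b + 1)\<close> differ, that is, if
  \<open>a = b\<close> or \<open>a = b + 1\<close>. One extra element common to the even vertices and two common to
  the odd vertices give vertices of equal parity intersecting labels and make all labels have
  \<open>m + 1\<close> elements.
\<close>

text \<open>The reflected construction: \<open>H\<close> runs through the code on \<open>m\<close>
  bits and then backwards through it, at the mirrored index \<open>r a\<close>, with bit
  \<open>m\<close> added. A word is encoded as the set of positions of its ones.\<close>

lemma gray_code_exists:
  "\<exists>G :: nat \<Rightarrow> nat set. inj_on G {..<2^m} \<and> (\<forall>a<2^m. G a \<subseteq> {..<m}) \<and>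
     (\<forall>a. Suc a < 2^m \<longrightarrow> (\<exists>p<m. \<forall>q. (q \<in> G a \<longleftrightarrow> q \<in> G (Suc a)) \<longleftrightarrow> q \<noteq> p))"
proof (induction m)
  case 0
  show ?case by (rule exI[of _ "\<lambda>_. {}"]) (simp add: lessThan_Suc)
next
  case (Suc m)
  then obtain G :: "nat \<Rightarrow> nat set" where
    inj: "inj_on G {..<2^m}" and sub: "\<And>a. a < 2^m \<Longrightarrow> G a \<subseteq> {..<m}" and
    step: "\<And>a. Suc a < 2^m \<Longrightarrow> \<exists>p<m. \<forall>q. (q \<in> G a \<longleftrightarrow> q \<in> G (Suc a)) \<longleftrightarrow> q \<noteq> p"
    by blast
  define r :: "nat \<Rightarrow> nat" where "r = (\<lambda>a. 2^Suc m - 1 - a)"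
  define H where "H = (\<lambda>a. if a < 2^m then G a else insert m (G (r a)))"
  have r: "r a < 2^m" if "\<not> a < 2^m" "a < 2^Suc m" for a
    using that by (auto simp: r_def)
  have top: "m \<in> H a \<longleftrightarrow> \<not> a < 2^m" if "a < 2^Suc m" for a
    using that sub by (auto simp: H_def)
  have rest: "H a - {m} = G (if a < 2^m then a else r a)" if "a < 2^Suc m" for a
    using that sub r by (auto simp: H_def)
  have "inj_on H {..<2^Suc m}"
  proof (rule inj_onI)
    fix a b assume "a \<in> {..<(2::nat)^Suc m}" "b \<in> {..<(2::nat)^Suc m}" and eq: "H a = H b"
    then have a: "a < 2^Suc m" and b: "b < 2^Suc m" by auto
    have iff: "a < 2^m \<longleftrightarrow> b < 2^m" using top[OF a] top[OF b] eq by auto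
    have "G (if a < 2^m then a else r a) = G (if b < 2^m then b else r b)"
      using rest[OF a] rest[OF b] eq by simp
    then have "(if a < 2^m then a else r a) = (if b < 2^m then b else r b)"
      by (rule inj_onD[OF inj]) (use r a b in auto)
    then show "a = b" using iff a b by (auto simp: r_def split: if_splits)
  qed
  moreover have "H a \<subseteq> {..<Suc m}" if "a < 2^Suc m" for a
    using sub[of a] sub[of "r a"] r[of a] that
    by (auto simp: H_def subset_iff intro: less_SucI)
  moreover have "\<exists>p<Suc m. \<forall>q. (q \<in> H a \<longleftrightarrow> q \<in> H (Suc a)) \<longleftrightarrow> q \<noteq> p" if a: "Suc a < 2^Suc m" for a
  proof -
    consider "Suc a < 2^m" | "Suc a = 2^m" | "2^m \<le> a" by linarith
    then show ?thesis
    proof cases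
      case 1
      then show ?thesis using step[OF 1] by (auto simp: H_def intro: less_SucI)
    next
      case 2
      then have "r (Suc a) = a" by (simp add: r_def flip: 2)
      then have "H a = G a" "H (Suc a) = insert m (G a)" "m \<notin> G a"
        using 2 sub[of a] by (auto simp: H_def)
      then show ?thesis by (intro exI[of _ m]) auto
    next
      case 3
      \<comment> \<open>The mirror reverses the order, so passing from \<open>a\<close> to
        \<open>Suc a\<close> is a step of \<open>G\<close> taken backwards.\<close>
      have ra: "r a = Suc (r (Suc a))" using a by (simp add: r_def)
      have "Suc (r (Suc a)) < 2^m" using r[of a] 3 a ra by simp
      from step[OF this] obtain p
        where p: "p < m" "\<forall>q. (q \<in> G (r (Suc a)) \<longleftrightarrow> q \<in> G (r a)) \<longleftrightarrow> q \<noteq> p"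
        unfolding ra by blast
      have "H a = insert m (G (r a))" "H (Suc a) = insert m (G (r (Suc a)))"
        using 3 by (auto simp: H_def)
      then show ?thesis using p by (intro exI[of _ p]) auto
    qed
  qed
  ultimately show ?case by (intro exI[of _ H]) blast
qed

text \<open>Injectivity comes for free because a path on at least four vertices has no two vertices with
  the same neighbourhood.\<close>

lemma inj_on_path_labelling:
  assumes "n \<ge> 4"
    and ne: "\<And>i. i < n \<Longrightarrow> f i \<noteq> {}"
    and adj: "\<And>i j. i < n \<Longrightarrow> j < n \<Longrightarrow> i \<noteq> j \<Longrightarrow> (j = Suc i \<or> i = Suc j) \<longleftrightarrow> f i \<inter> f j = {}"
  shows "inj_on f {..<n}"
proof (rule linorder_inj_onI')
  fix u v assume "u \<in> {..<n}" "v \<in> {..<n}" "u < v"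
  then have uv: "u < n" "v < n" "u < v" by auto
  show "f u \<noteq> f v"
  proof
    assume eq: "f u = f v"
    have "v \<noteq> Suc u" using adj[of u v] ne[of u] uv eq by auto
    have nb: "(w = Suc u \<or> u = Suc w) \<longleftrightarrow> (w = Suc v \<or> v = Suc w)"
      if "w < n" "w \<noteq> u" "w \<noteq> v" for w
      using adj[of u w] adj[of v w] that uv eq by auto
    \<comment> \<open>Otherwise \<open>u - 1\<close> would be a neighbour of \<open>u\<close>, hence
      of \<open>v\<close>, although it lies at least two below \<open>v\<close>.\<close>
    have "u = 0" using nb[of "u - 1"] uv by (cases u) auto
    moreover have "\<not> Suc v < n" using nb[of "Suc v"] uv by auto
    then have "v = n - 1" using uv by linarith
    \<comment> \<open>Vertex \<open>1\<close> is adjacent to the end \<open>0\<close> but not to the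
      end \<open>n - 1 \<ge> 3\<close>. On three vertices the two ends do share their
      neighbourhood.\<close>
    ultimately show False
      using nb[of 1] \<open>n \<ge> 4\<close> by linarith
  qed
qed

lemma UUSN_path_graph_le:
  assumes "n \<ge> 4" "n \<le> 2^m"
  shows "UUSN (path_graph n) \<le> 2 * m + 4"
proof -
  obtain G :: "nat \<Rightarrow> nat set" where
    inj: "inj_on G {..<2^m}" and sub: "\<And>a. a < 2^m \<Longrightarrow> G a \<subseteq> {..<m}" and
    step: "\<And>a. Suc a < 2^m \<Longrightarrow> \<exists>p<m. \<forall>q. (q \<in> G a \<longleftrightarrow> q \<in> G (Suc a)) \<longleftrightarrow> q \<noteq> p"
    using gray_code_exists[of m] by blast
  \<comment> \<open>A pair \<open>(q, x)\<close> with \<open>q < m\<close> stands for bit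
    \<open>q\<close> having value \<open>x\<close>; the pairs at \<open>m\<close> and
    \<open>Suc m\<close> are the common elements of each parity class.\<close>
  define E where "E = (\<lambda>a. insert (m, True) ((\<lambda>q. (q, q \<in> G a)) ` {..<m}))"
  define D where "D = (\<lambda>b. insert (m, False) (insert (Suc m, False)
    ((\<lambda>q. (q, q \<notin> G b)) ` {q. q < m \<and> (q \<in> G b \<longleftrightarrow> q \<in> G (Suc b))})))"
  define f where "f = (\<lambda>i. if even i then E (i div 2) else D (i div 2))"
  have EE: "E a \<inter> E b \<noteq> {}" and DD: "D a \<inter> D b \<noteq> {}" for a b
    by (auto simp: E_def D_def)
  have ED: "E a \<inter> D b = {} \<longleftrightarrow> a = b \<or> a = Suc b" if ab: "a < 2^m" "Suc b < 2^m" for a b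
  proof -
    obtain p where p: "p < m" "\<forall>q. (q \<in> G b \<longleftrightarrow> q \<in> G (Suc b)) \<longleftrightarrow> q \<noteq> p"
      using step[OF ab(2)] by blast
    have "E a \<inter> D b = {} \<longleftrightarrow> (\<forall>q<m. q \<noteq> p \<longrightarrow> (q \<in> G a \<longleftrightarrow> q \<in> G b))"
    proof -
      have "(q, x) \<in> E a \<longleftrightarrow> (q < m \<and> (x \<longleftrightarrow> q \<in> G a)) \<or> (q = m \<and> x)" for q x
        by (auto simp: E_def)
      moreover have "(q, x) \<in> D b \<longleftrightarrow>
          (q < m \<and> q \<noteq> p \<and> (x \<longleftrightarrow> q \<notin> G b)) \<or> (q \<in> {m, Suc m} \<and> \<not> x)" for q x
        unfolding D_def p(2)[rule_format] by auto
      ultimately show ?thesis by (auto simp: disjoint_iff)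
    qed
    \<comment> \<open>Both words have only zeros from position \<open>m\<close> on.\<close>
    also have "\<dots> \<longleftrightarrow> (\<forall>q. q \<noteq> p \<longrightarrow> (q \<in> G a \<longleftrightarrow> q \<in> G b))"
      using sub[of a] sub[of b] ab by auto
    also have "\<dots> \<longleftrightarrow> G a = G b \<or> G a = G (Suc b)"
      using p(2) unfolding set_eq_iff by metis
    also have "\<dots> \<longleftrightarrow> a = b \<or> a = Suc b"
      using inj_on_eq_iff[OF inj, of a b] inj_on_eq_iff[OF inj, of a "Suc b"] ab by auto
    finally show ?thesis .
  qed
  have cardE: "card (E a) = m + 1" for a
    unfolding E_def by (subst card_insert_disjoint) (auto simp: card_image inj_on_def)
  have cardD: "card (D b) = m + 1" if b: "Suc b < 2^m" for b
  proof -
    obtain p where p: "p < m" "\<forall>q. (q \<in> G b \<longleftrightarrow> q \<in> G (Suc b)) \<longleftrightarrow> q \<noteq> p"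
      using step[OF b] by blast
    have agree: "{q. q < m \<and> (q \<in> G b \<longleftrightarrow> q \<in> G (Suc b))} = {..<m} - {p}"
      using p by auto
    have D: "D b = insert (m, False) (insert (Suc m, False)
        ((\<lambda>q. (q, q \<notin> G b)) ` ({..<m} - {p})))"
      unfolding D_def agree ..
    have "card ((\<lambda>q. (q, q \<notin> G b)) ` ({..<m} - {p})) = m - 1"
      using p(1) by (subst card_image) (auto simp: inj_on_def)
    moreover have "(m, False) \<notin> insert (Suc m, False) ((\<lambda>q. (q, q \<notin> G b)) ` ({..<m} - {p}))"
      "(Suc m, False) \<notin> (\<lambda>q. (q, q \<notin> G b)) ` ({..<m} - {p})"
      by auto
    \<comment> \<open>\<open>p < m\<close> forces \<open>m > 0\<close>, so the truncated
      \<open>m - 1\<close> plus the two common elements is \<open>m + 1\<close>.\<close>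
    ultimately show ?thesis using p(1) unfolding D by simp
  qed
  \<comment> \<open>For odd \<open>i = 2 * b + 1\<close> the bound is
    \<open>b + 1 \<le> i < 2^m\<close>. Thus \<open>G (Suc b)\<close> lies in the code even if
    \<open>i\<close> is the last vertex of the path.\<close>
  have small: "i div 2 < 2^m" "odd i \<Longrightarrow> Suc (i div 2) < 2^m" if "i < n" for i
    using that assms by (auto elim!: oddE)
  have ED': "(j = Suc i \<or> i = Suc j) \<longleftrightarrow> f i \<inter> f j = {}"
    if ij: "i < n" "j < n" "even i" "odd j" for i j
  proof -
    obtain a b where ab: "i = 2 * a" "j = 2 * b + 1" using ij(3,4) by (elim evenE oddE)
    then have "f i \<inter> f j = {} \<longleftrightarrow> a = b \<or> a = Suc b"
      using ED[of a b] small(1)[OF ij(1)] small(2)[OF ij(2,4)] by (simp add: f_def)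
    then show ?thesis unfolding ab by presburger
  qed
  have adj: "(j = Suc i \<or> i = Suc j) \<longleftrightarrow> f i \<inter> f j = {}" if "i < n" "j < n" for i j
  proof -
    consider "even i" "odd j" | "odd i" "even j" | "even i \<longleftrightarrow> even j" by blast
    then show ?thesis
    proof cases
      case 1
      then show ?thesis using ED' that by blast
    next
      case 2
      then show ?thesis using ED'[OF that(2,1)] by blast
    next
      case 3
      then show ?thesis using EE DD by (auto simp: f_def)
    qed
  qed
  have ne: "f i \<noteq> {}" for i by (auto simp: f_def E_def D_def)
  have "inj_on f {..<n}"
    using \<open>n \<ge> 4\<close> ne adj by (rule inj_on_path_labelling)
  moreover have "f i \<subseteq> {..Suc m} \<times> UNIV" for i
    by (auto simp: f_def E_def D_def)
  moreover have "card (f i) = m + 1" if "i < n" for i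
    using cardE cardD small that by (simp add: f_def)
  ultimately have "uniform_valid_labelling (path_graph n) ({..Suc m} \<times> (UNIV :: bool set)) f"
    using adj ne by (auto simp: uniform_valid_labelling_def valid_labelling_def path_graph_def)
  then have "UUSN (path_graph n) \<le> card ({..Suc m} \<times> (UNIV :: bool set))"
    by (rule UUSN_le)
  then show ?thesis by (simp add: card_cartesian_product)
qed

theorem theorem23:
  shows "\<exists>C::real. C > 0 \<and> (\<exists>n0::nat. \<forall>n\<ge>n0. real (UUSN (path_graph n)) \<le> C * ln (real n))"
proof -
  have "real (UUSN (path_graph n)) \<le> 5 / ln 2 * ln (real n)" if n: "n \<ge> 4" for n
  proof -
    define m where "m = nat \<lceil>log 2 (real n)\<rceil>"
    have L: "2 \<le> log 2 (real n)" using n by (simp add: le_log_iff)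
    have m: "log 2 (real n) \<le> real m" "real m \<le> log 2 (real n) + 1"
      using L unfolding m_def by linarith+
    have "real n \<le> 2 powr real m" using m(1) n by (simp add: log_le_iff)
    then have "real n \<le> real (2^m)" by (simp add: powr_realpow)
    then have "n \<le> 2^m" by (simp only: of_nat_le_iff)
    then have "real (UUSN (path_graph n)) \<le> 2 * real m + 4"
      using UUSN_path_graph_le[OF n, of m] by linarith
    \<comment> \<open>With \<open>L = log 2 n\<close>,
      \<open>2 * m + 4 \<le> 2 * L + 6 \<le> 5 * L\<close>, the last because
      \<open>n \<ge> 4\<close> gives \<open>L \<ge> 2\<close>.\<close>
    also have "\<dots> \<le> 5 * log 2 (real n)" using m L by linarith
    finally show ?thesis by (simp add: log_def)
  qed
  then show ?thesis by (intro exI[of _ "5 / ln 2"] conjI exI[of _ 4]) auto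
qed

end
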